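(* Let each $\mathcal{U}_i$, $i\in I$, be a polyhedral uncertainty set of the form $\mathcal{U}_i=\mathrm{co}\,\mathcal{U}_i^{ep}+\mathrm{co}\,\mathrm{cone}\,\mathcal{U}_i^{ed}$ with finite sets $\mathcal{U}_i^{ep},\mathcal{U}_i^{ed}\subseteq X^*$. Then $\bar{x}\in\Omega$ is a highly robust efficient solution of $(P_{\mathcal{U}})$ if and only if it is a highly robust efficient solution of $(P_{\mathcal{U}^{epd}})$.
   Context: Setting: $X$ is a real Banach space with dual $X^*$ and pairing $\langle\cdot,\cdot\rangle$; $p\ge 2$, $I=\{1,\dots,p\}$; $f=(f_1,\dots,f_p):X\to\mathbb{R}^p$; $\Omega\subseteq X$ is nonempty (the robust feasible set). For $u\in(X^* )^p$ put $f_i(x,u_i)=f_i(x)-\langle u_i,x\rangle$ and $f(x,u)=(f_1(x,u_1),\dots,f_p(x,u_p))$. $(P_u)$ is the problem of minimizing $f(x,u)$ over $x\in\Omega$, and for $\mathcal{W}\subseteq(X^* )^p$, $(P_{\mathcal{W}})$ is the family $(P_u)_{u\in\mathcal{W}}$. For $a,b\in\mathbb{R}^p$, $a\le b$ iff $a_i\le b_i$ for all $i$ and $a\ne b$. $\bar x\in\Omega$ is a highly robust efficient solution of $(P_{\mathcal{W}})$ if for every $u\in\mathcal{W}$ there is no $x\in\Omega\setminus\{\bar x\}$ with $f(x,u)\le f(\bar x,u)$. Polyhedral uncertainty sets: $\mathcal{U}_i^{ep}=\{w_1^i,\dots,w_{s_i}^i\}\subseteq X^*$ is a nonempty finite vertex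 set and $\mathcal{U}_i^{ed}=\{d_1^i,\dots,d_{r_i}^i\}\subseteq X^*$ is a finite set of directions ($\mathcal{U}_i^{ed}=\emptyset$ when $\mathcal{U}_i$ is bounded). $\mathcal{U}_i=\mathrm{co}\,\mathcal{U}_i^{ep}+\mathrm{co}\,\mathrm{cone}\,\mathcal{U}_i^{ed}$ is the set of all $\sum_{k=1}^{s_i}\alpha_k w_k^i+\sum_{t=1}^{r_i}\beta_t d_t^i$ with $\alpha_k\ge0$, $\sum_k\alpha_k=1$, $\beta_t\ge0$. $\mathcal{U}=\prod_{i=1}^p\mathcal{U}_i$. $\mathcal{U}_i^{epd}=\{w_k^i+\gamma d_t^i:\gamma\ge0,\ k=1,\dots,s_i,\ t=1,\dots,r_i\}$, with the convention $\mathcal{U}_i^{epd}=\mathcal{U}_i^{ep}$ if $\mathcal{U}_i^{ed}=\emptyset$, and $\mathcal{U}^{epd}=\mathcal{U}_1^{epd}\times\dots\times\mathcal{U}_p^{epd}$. *)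

theory Defs
  imports "HOL-Analysis.Analysis"
begin

definition pareto_less :: "real ^ 'p \<Rightarrow> real ^ 'p \<Rightarrow> bool" where
  "pareto_less a b \<longleftrightarrow> (\<forall>i. a $ i \<le> b $ i) \<and> a \<noteq> b"

definition perturbed ::
  "('a::real_normed_vector \<Rightarrow> real ^ 'p) \<Rightarrow> ('a \<Rightarrow>\<^sub>L real) ^ 'p \<Rightarrow> 'a \<Rightarrow> real ^ 'p" where
  "perturbed f u x = (\<chi> i. f x $ i - blinfun_apply (u $ i) x)"

definition highly_robust_efficient ::
  "('a::real_normed_vector \<Rightarrow> real ^ 'p) \<Rightarrow> 'a set \<Rightarrow> (('a \<Rightarrow>\<^sub>L real) ^ 'p) set \<Rightarrow> 'a \<Rightarrow> bool" where
  "highly_robust_efficient f \<Omega> W xb \<longleftrightarrow>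
     xb \<in> \<Omega> \<and>
     (\<forall>u\<in>W. \<not> (\<exists>x\<in>\<Omega> - {xb}. pareto_less (perturbed f u x) (perturbed f u xb)))"

text \<open>
  The convex hull of the vertices \<open>V\<close> plus the convex cone generated by the directions \<open>D\<close>,
  for finite \<open>V\<close> and \<open>D\<close>.  It is spelled out with coefficients because \<open>cone hull {}\<close>
  is empty in the library, whereas here \<open>D = {}\<close> must contribute \<open>{0}\<close>.
\<close>

definition polyhedral_set :: "'b::real_vector set \<Rightarrow> 'b set \<Rightarrow> 'b set" where
  "polyhedral_set V D =
     {(\<Sum>w\<in>V. \<alpha> w *\<^sub>R w) + (\<Sum>d\<in>D. \<beta> d *\<^sub>R d) | \<alpha> \<beta>.
        (\<forall>w\<in>V. 0 \<le> \<alpha> w) \<and> (\<Sum>w\<in>V. \<alpha> w) = 1 \<and> (\<forall>d\<in>D. 0 \<le> \<beta> d)}"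

definition vertex_rays :: "'b::real_vector set \<Rightarrow> 'b set \<Rightarrow> 'b set" where
  "vertex_rays V D =
     (if D = {} then V else {w + \<gamma> *\<^sub>R d | w \<gamma> d. w \<in> V \<and> 0 \<le> \<gamma> \<and> d \<in> D})"

definition vec_product :: "('p \<Rightarrow> 'b set) \<Rightarrow> ('b ^ 'p) set" where
  "vec_product U = {u. \<forall>i. u $ i \<in> U i}"

end

theory Submission
  imports Defs
begin

text \<open>
  For a fixed competitor \<open>x\<close>, the point \<open>xb\<close> is dominated under \<open>u\<close> exactly when
  \<open>f x $ i - f xb $ i \<le> u $ i (x - xb)\<close> for every \<open>i\<close>, with strict inequality for some \<open>i\<close>.
  Hence domination survives any change of \<open>u\<close> that does not decrease the numbers
  \<open>u $ i (x - xb)\<close> (\<open>pareto_less_perturbed_mono\<close>).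

  These numbers are the values of a linear functional at the components \<open>u $ i\<close>, and on a
  polyhedral set every value of a linear functional is matched or exceeded at a vertex or, if the
  functional grows along one of the directions, on a ray in that direction
  (\<open>polyhedral_set_functional_le_vertex_rays\<close>).  The product structure allows this
  replacement independently in each component, so domination under some element of the polyhedral
  product forces domination by the same \<open>x\<close> under some element of the product of the vertex rays.
  The converse holds because the vertex rays are contained in the polyhedral sets
  (\<open>vertex_rays_subset_polyhedral_set\<close>).
\<close>

lemma vertex_rays_subset_polyhedral_set:
  assumes "finite V" "finite D"
  shows "vertex_rays V D \<subseteq> polyhedral_set V D"
proof
  fix u assume u: "u \<in> vertex_rays V D"
  \<comment> \<open>One representation for both cases of \<open>vertex_rays\<close>: if \<open>D = {}\<close>, the ray term vanishes.\<close>
  obtain w \<gamma> d where w: "w \<in> V" and \<gamma>: "0 \<le> \<gamma>"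
    and u_eq: "u = w + (if d \<in> D then \<gamma> *\<^sub>R d else 0)"
  proof (cases "D = {}")
    case True
    then show ?thesis using u that[of u 0] by (simp add: vertex_rays_def)
  next
    case False
    then obtain w \<gamma> d where "u = w + \<gamma> *\<^sub>R d" "w \<in> V" "0 \<le> \<gamma>" "d \<in> D"
      using u by (auto simp: vertex_rays_def)
    then show ?thesis using that[of w \<gamma> d] by simp
  qed
  define \<alpha> where "\<alpha> = (\<lambda>v. if v = w then 1 else 0 :: real)"
  define \<beta> where "\<beta> = (\<lambda>e. if e = d then \<gamma> else 0)"
  have "(\<Sum>v\<in>V. \<alpha> v *\<^sub>R v) = (\<Sum>v\<in>V. if v = w then v else 0)"
    by (rule sum.cong) (auto simp: \<alpha>_def)
  moreover have "(\<Sum>e\<in>D. \<beta> e *\<^sub>R e) = (\<Sum>e\<in>D. if e = d then \<gamma> *\<^sub>R e else 0)"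
    by (rule sum.cong) (auto simp: \<beta>_def)
  ultimately have "u = (\<Sum>v\<in>V. \<alpha> v *\<^sub>R v) + (\<Sum>e\<in>D. \<beta> e *\<^sub>R e)"
    using assms w by (simp add: u_eq)
  moreover have "(\<Sum>v\<in>V. \<alpha> v) = 1"
    using assms w by (simp add: \<alpha>_def)
  moreover have "\<forall>v\<in>V. 0 \<le> \<alpha> v" "\<forall>e\<in>D. 0 \<le> \<beta> e"
    using \<gamma> by (simp_all add: \<alpha>_def \<beta>_def)
  ultimately show "u \<in> polyhedral_set V D"
    unfolding polyhedral_set_def by blast
qed

text \<open>
  A convex combination of the values at the vertices is at most the largest of them.  If the
  functional is positive at some direction, it is unbounded above on the corresponding ray;
  otherwise the conic part contributes nothing positive, and the best vertex, the endpoint of a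
  ray, already suffices.
\<close>

lemma polyhedral_set_functional_le_vertex_rays:
  fixes \<phi> :: "'b::real_vector \<Rightarrow> real"
  assumes "finite V" "linear \<phi>" "u \<in> polyhedral_set V D"
  obtains v where "v \<in> vertex_rays V D" "\<phi> u \<le> \<phi> v"
proof -
  obtain \<alpha> \<beta> where u: "u = (\<Sum>w\<in>V. \<alpha> w *\<^sub>R w) + (\<Sum>d\<in>D. \<beta> d *\<^sub>R d)"
    and \<alpha>: "\<And>w. w \<in> V \<Longrightarrow> 0 \<le> \<alpha> w" "(\<Sum>w\<in>V. \<alpha> w) = 1" and \<beta>: "\<And>d. d \<in> D \<Longrightarrow> 0 \<le> \<beta> d"
    using assms(3) unfolding polyhedral_set_def by blast
  have \<phi>u: "\<phi> u = (\<Sum>w\<in>V. \<alpha> w * \<phi> w) + (\<Sum>d\<in>D. \<beta> d * \<phi> d)"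
    using assms(2) by (simp add: u linear_add linear_sum linear_scale)
  have "V \<noteq> {}" using \<alpha>(2) by auto
  then have "Max (\<phi> ` V) \<in> \<phi> ` V"
    using assms(1) by simp
  then obtain w where w: "w \<in> V" "\<phi> w = Max (\<phi> ` V)"
    by auto
  have "(\<Sum>v\<in>V. \<alpha> v * \<phi> v) \<le> (\<Sum>v\<in>V. \<alpha> v * \<phi> w)"
    using assms(1) \<alpha>(1) w(2) by (intro sum_mono mult_left_mono) auto
  also have "\<dots> = \<phi> w"
    using \<alpha>(2) by (simp flip: sum_distrib_right)
  finally have vertex_part: "(\<Sum>v\<in>V. \<alpha> v * \<phi> v) \<le> \<phi> w" .
  show thesis
  proof (cases "\<exists>d\<in>D. 0 < \<phi> d")
    case True
    then obtain d where d: "d \<in> D" "0 < \<phi> d" by blast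
    define \<gamma> where "\<gamma> = max 0 ((\<phi> u - \<phi> w) / \<phi> d)"
    have "w + \<gamma> *\<^sub>R d \<in> vertex_rays V D"
    proof -
      have "0 \<le> \<gamma>" by (simp add: \<gamma>_def)
      with w(1) d(1) show ?thesis unfolding vertex_rays_def by auto
    qed
    moreover have "\<phi> u - \<phi> w \<le> \<gamma> * \<phi> d"
      using d(2) by (simp add: \<gamma>_def flip: pos_divide_le_eq)
    then have "\<phi> u \<le> \<phi> (w + \<gamma> *\<^sub>R d)"
      using assms(2) by (simp add: linear_add linear_scale)
    ultimately show thesis by (rule that)
  next
    case False
    have "(\<Sum>d\<in>D. \<beta> d * \<phi> d) \<le> 0"
      using False \<beta> by (intro sum_nonpos mult_nonneg_nonpos) auto
    then have "\<phi> u \<le> \<phi> w" using \<phi>u vertex_part by simp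
    moreover have "w \<in> vertex_rays V D"
      using w(1) by (force simp: vertex_rays_def)
    ultimately show thesis using that by blast
  qed
qed

lemma pareto_less_iff_strict_component:
  "pareto_less a b \<longleftrightarrow> (\<forall>i. a $ i \<le> b $ i) \<and> (\<exists>i. a $ i < b $ i)"
  unfolding pareto_less_def vec_eq_iff by (metis order_less_le)

text \<open>
  Only the differences \<open>perturbed f u y $ i - perturbed f u x $ i\<close> matter, and they increase with
  \<open>u $ i (x - y)\<close>; this keeps the weak inequalities and the strict one alike.
\<close>

lemma pareto_less_perturbed_mono:
  assumes "pareto_less (perturbed f u x) (perturbed f u y)"
    and le: "\<And>i. blinfun_apply (u $ i) (x - y) \<le> blinfun_apply (v $ i) (x - y)"
  shows "pareto_less (perturbed f v x) (perturbed f v y)"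
proof -
  have gap: "perturbed f u y $ i - perturbed f u x $ i \<le> perturbed f v y $ i - perturbed f v x $ i" for i
    using le[of i] by (simp add: perturbed_def blinfun.diff_right)
  show ?thesis
    unfolding pareto_less_iff_strict_component
  proof (intro conjI allI)
    fix i
    have "perturbed f u x $ i \<le> perturbed f u y $ i"
      using assms(1) by (simp add: pareto_less_iff_strict_component)
    then show "perturbed f v x $ i \<le> perturbed f v y $ i"
      using gap[of i] by linarith
  next
    obtain i where "perturbed f u x $ i < perturbed f u y $ i"
      using assms(1) by (auto simp: pareto_less_iff_strict_component)
    then have "perturbed f v x $ i < perturbed f v y $ i"
      using gap[of i] by linarith
    then show "\<exists>i. perturbed f v x $ i < perturbed f v y $ i" ..
  qed
qed

theorem theorem17:
  fixes f :: "'a::banach \<Rightarrow> real ^ 'p"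
    and \<Omega> :: "'a set"
    and xb :: 'a
    and Uep Ued :: "'p \<Rightarrow> ('a \<Rightarrow>\<^sub>L real) set"
  assumes "2 \<le> CARD('p)"
    and "\<Omega> \<noteq> {}"
    and "\<And>i. finite (Uep i)"
    and "\<And>i. Uep i \<noteq> {}"
    and "\<And>i. finite (Ued i)"
    and "xb \<in> \<Omega>"
  shows "highly_robust_efficient f \<Omega> (vec_product (\<lambda>i. polyhedral_set (Uep i) (Ued i))) xb
     \<longleftrightarrow> highly_robust_efficient f \<Omega> (vec_product (\<lambda>i. vertex_rays (Uep i) (Ued i))) xb"
proof
  assume poly: "highly_robust_efficient f \<Omega> (vec_product (\<lambda>i. polyhedral_set (Uep i) (Ued i))) xb"
  have "vec_product (\<lambda>i. vertex_rays (Uep i) (Ued i))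
      \<subseteq> vec_product (\<lambda>i. polyhedral_set (Uep i) (Ued i))"
    using vertex_rays_subset_polyhedral_set[OF assms(3,5)] by (auto simp: vec_product_def)
  then show "highly_robust_efficient f \<Omega> (vec_product (\<lambda>i. vertex_rays (Uep i) (Ued i))) xb"
    using poly unfolding highly_robust_efficient_def by blast
next
  assume rays: "highly_robust_efficient f \<Omega> (vec_product (\<lambda>i. vertex_rays (Uep i) (Ued i))) xb"
  have False
    if u: "u \<in> vec_product (\<lambda>i. polyhedral_set (Uep i) (Ued i))"
      and x: "x \<in> \<Omega> - {xb}" and dom: "pareto_less (perturbed f u x) (perturbed f u xb)" for u x
  proof -
    have lin: "linear (\<lambda>v::'a \<Rightarrow>\<^sub>L real. blinfun_apply v (x - xb))"
      by (rule linearI) (simp_all add: blinfun.add_left blinfun.scaleR_left)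
    have "\<exists>v. v \<in> vertex_rays (Uep i) (Ued i)
        \<and> blinfun_apply (u $ i) (x - xb) \<le> blinfun_apply v (x - xb)" for i
    proof -
      have "u $ i \<in> polyhedral_set (Uep i) (Ued i)" using u by (simp add: vec_product_def)
      then show ?thesis
        using polyhedral_set_functional_le_vertex_rays[OF assms(3) lin] by metis
    qed
    then obtain v where v: "\<And>i. v i \<in> vertex_rays (Uep i) (Ued i)"
      "\<And>i. blinfun_apply (u $ i) (x - xb) \<le> blinfun_apply (v i) (x - xb)"
      by metis
    have "pareto_less (perturbed f (\<chi> i. v i) x) (perturbed f (\<chi> i. v i) xb)"
      using dom by (rule pareto_less_perturbed_mono) (simp add: v(2))
    moreover have "(\<chi> i. v i) \<in> vec_product (\<lambda>i. vertex_rays (Uep i) (Ued i))"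
      by (simp add: vec_product_def v(1))
    ultimately show False
      using rays x unfolding highly_robust_efficient_def by blast
  qed
  then show "highly_robust_efficient f \<Omega> (vec_product (\<lambda>i. polyhedral_set (Uep i) (Ued i))) xb"
    using assms(6) unfolding highly_robust_efficient_def by blast
qed

end
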